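(* There exist $C^\infty$ diffeomorphisms $T_1$ and $T_2$ of the torus $\mathbb{T}^2=\mathbb{R}^2/\mathbb{Z}^2$ such that: (i) there exist constants $\tau>0$ and $C>0$ such that for every $x\in\mathbb{T}^2$ and every integer $n\ge 1$, $$\mathrm{dist}(T_1^n x,x)\ge C n^{-\tau},\qquad \mathrm{dist}(T_2^n x,x)\ge C n^{-\tau};$$ (ii) $T_1$ and $T_2$ are $C^0$ conjugate, but not $C^1$ conjugate.
   Context: $\mathrm{dist}$ is the distance of the standard flat metric on $\mathbb{T}^2$. Two diffeomorphisms $T_1,T_2$ of a manifold $M$ are $C^0$ (topologically) conjugate if there is a homeomorphism $h:M\to M$ with $h\circ T_1=T_2\circ h$; they are $C^1$ conjugate if such an $h$ can be chosen to be a $C^1$ diffeomorphism. *)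

theory Defs
  imports "HOL-Analysis.Analysis"
begin

section \<open>The flat torus\<close>

definition integer_translate :: "real \<times> real \<Rightarrow> real \<times> real \<Rightarrow> bool" where
  "integer_translate a b \<longleftrightarrow> fst b - fst a \<in> \<int> \<and> snd b - snd a \<in> \<int>"

lemma equivp_integer_translate: "equivp integer_translate"
proof (rule equivpI)
  show "reflp integer_translate"
    by (auto simp: reflp_def integer_translate_def)
  show "symp integer_translate"
    by (auto simp: symp_def integer_translate_def) (metis Ints_minus minus_diff_eq)+
  show "transp integer_translate"
    by (auto simp: transp_def integer_translate_def) (metis Ints_add diff_add_cancel add_diff_eq)+
qed

quotient_type torus = "real \<times> real" / integer_translate
  morphisms rep_torus to_torus
  by (rule equivp_integer_translate)

lemma to_torus_eq_iff: "to_torus a = to_torus b \<longleftrightarrow> fst b - fst a \<in> \<int> \<and> snd b - snd a \<in> \<int>"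
  using torus.abs_eq_iff[of a b] by (simp add: integer_translate_def)

lemma to_torus_surj: "\<exists>a. to_torus a = p"
  by (metis Quotient_abs_rep Quotient_torus)

lemma to_torus_shift:
  assumes "to_torus a = to_torus a'"
  shows "to_torus (b + (a' - a)) = to_torus b"
  using assms by (auto simp: to_torus_eq_iff) (metis Ints_minus minus_diff_eq)+

lemma to_torus_discrete:
  assumes "to_torus a = to_torus b" "dist a b < 1"
  shows "a = b"
proof -
  have eq: "u = v" if int: "v - u \<in> \<int>" and lt: "\<bar>u - v\<bar> < 1" for u v :: real
  proof -
    obtain i where i: "v - u = of_int i" using int by (rule Ints_cases)
    then have "\<bar>real_of_int i\<bar> < 1" using lt by linarith
    then have "i = 0" by linarith
    then show ?thesis using i by simp
  qed
  have "\<bar>fst a - fst b\<bar> < 1" "\<bar>snd a - snd b\<bar> < 1"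
    using assms(2) dist_fst_le[of a b] dist_snd_le[of a b] by (simp_all add: dist_real_def)
  then show ?thesis
    using assms(1) eq by (auto simp: to_torus_eq_iff prod_eq_iff)
qed

instantiation torus :: metric_space
begin

text \<open>
  The distance of the flat metric: the infimum of the Euclidean distances between the
  representatives of the two points. (The norm on \<^typ>\<open>real \<times> real\<close> is the Euclidean one.)
\<close>
definition dist_torus :: "torus \<Rightarrow> torus \<Rightarrow> real" where
  "dist p q = setdist (to_torus -` {p}) (to_torus -` {q})"

definition uniformity_torus :: "(torus \<times> torus) filter" where
  "uniformity_torus = (INF e\<in>{0<..}. principal {(p, q). dist p q < e})"

definition open_torus :: "torus set \<Rightarrow> bool" where
  "open_torus U \<longleftrightarrow> (\<forall>p\<in>U. \<forall>\<^sub>F (p', q) in uniformity. p' = p \<longrightarrow> q \<in> U)"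

lemma dist_to_torus_le_aux: "dist (to_torus a) (to_torus b) \<le> dist a b"
  unfolding dist_torus_def by (rule setdist_le_dist) auto

lemma dist_to_torus_lessE_aux:
  assumes "dist (to_torus a) q < e"
  obtains b where "to_torus b = q" "dist a b < e"
proof -
  have ne: "to_torus -` {to_torus a} \<noteq> {}" "to_torus -` {q} \<noteq> {}"
    using to_torus_surj[of q] by auto
  obtain x y where xy: "to_torus x = to_torus a" "to_torus y = q" "dist x y < e"
    using setdist_ltE[OF assms[unfolded dist_torus_def] ne] by (metis singletonD vimageD)
  have "to_torus (y + (a - x)) = q"
    using to_torus_shift[OF xy(1)] xy(2) by simp
  moreover have "dist a (y + (a - x)) < e"
    using xy(3) by (simp add: dist_norm algebra_simps)
  ultimately show ?thesis by (rule that)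
qed

instance
proof
  fix p q r :: torus
  show "dist p q = 0 \<longleftrightarrow> p = q"
  proof
    assume 0: "dist p q = 0"
    obtain a where a: "to_torus a = p" using to_torus_surj by blast
    obtain b where b: "to_torus b = q" "dist a b < 1/2"
      using dist_to_torus_lessE_aux[of a q "1/2"] 0 a by auto
    show "p = q"
    proof (rule ccontr)
      assume "p \<noteq> q"
      then have "dist a b > 0" using a b by auto
      then obtain c where c: "to_torus c = q" "dist a c < dist a b"
        using dist_to_torus_lessE_aux[of a q "dist a b"] 0 a by auto
      have "dist c b < 1"
        using dist_triangle3[of c b a] b c by linarith
      then have "c = b"
        using to_torus_discrete b c by simp
      then show False using c by simp
    qed
  next
    assume "p = q"
    then show "dist p q = 0" by (simp add: dist_torus_def setdist_refl)
  qed
  show "dist p q \<le> dist p r + dist q r"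
  proof (rule field_le_epsilon)
    fix e :: real assume e: "0 < e"
    obtain a where a: "to_torus a = r" using to_torus_surj by blast
    have sym: "dist r s = dist s r" for s :: torus
      by (simp add: dist_torus_def setdist_sym)
    obtain b where b: "to_torus b = p" "dist a b < dist p r + e/2"
      using dist_to_torus_lessE_aux[of a p "dist p r + e/2"] a e sym by auto
    obtain c where c: "to_torus c = q" "dist a c < dist q r + e/2"
      using dist_to_torus_lessE_aux[of a q "dist q r + e/2"] a e sym by auto
    have "dist p q \<le> dist b c"
      using dist_to_torus_le_aux[of b c] b c by simp
    also have "\<dots> \<le> dist a b + dist a c" by (rule dist_triangle3)
    finally show "dist p q \<le> dist p r + dist q r + e" using b c by simp
  qed
qed (simp_all add: uniformity_torus_def open_torus_def)

end

lemmas dist_to_torus_le = dist_to_torus_le_aux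
lemmas dist_to_torus_lessE = dist_to_torus_lessE_aux

lemma open_torus_iff: "open U \<longleftrightarrow> open (to_torus -` U)"
proof
  assume U: "open U"
  show "open (to_torus -` U)"
    unfolding open_dist
  proof
    fix a assume "a \<in> to_torus -` U"
    then obtain e where "e > 0" "\<And>q. dist q (to_torus a) < e \<Longrightarrow> q \<in> U"
      using U unfolding open_dist by auto
    then show "\<exists>e>0. \<forall>b. dist b a < e \<longrightarrow> b \<in> to_torus -` U"
      by (meson dist_to_torus_le order_le_less_trans vimageI2)
  qed
next
  assume U: "open (to_torus -` U)"
  show "open U"
    unfolding open_dist
  proof
    fix p assume p: "p \<in> U"
    obtain a where a: "to_torus a = p" using to_torus_surj by blast
    then obtain e where e: "e > 0" "\<And>b. dist b a < e \<Longrightarrow> to_torus b \<in> U"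
      using U p unfolding open_dist by (metis vimageD vimageI2)
    have "q \<in> U" if "dist q p < e" for q
      using that a e(2) by (metis dist_commute dist_to_torus_lessE)
    then show "\<exists>e>0. \<forall>q. dist q p < e \<longrightarrow> q \<in> U" using e(1) by blast
  qed
qed


section \<open>Differentiability classes\<close>

text \<open>For open \<^term>\<open>U\<close>; in the recursion, \<^term>\<open>v\<close> is the direction of a directional derivative.\<close>
primrec Ck_on :: "nat \<Rightarrow> ('a::euclidean_space \<Rightarrow> 'b::euclidean_space) \<Rightarrow> 'a set \<Rightarrow> bool" where
  "Ck_on 0 f U \<longleftrightarrow> continuous_on U f"
| "Ck_on (Suc k) f U \<longleftrightarrow>
     (\<forall>x\<in>U. f differentiable (at x)) \<and> (\<forall>v. Ck_on k (\<lambda>x. frechet_derivative f (at x) v) U)"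

text \<open>
  The charts of the torus are the local inverses of the covering map \<^const>\<open>to_torus\<close>, so
  a self-map is of class \<open>C\<^sup>k\<close> iff near every point it is induced by a \<open>C\<^sup>k\<close> map of the plane.
\<close>
definition torus_Ck :: "nat \<Rightarrow> (torus \<Rightarrow> torus) \<Rightarrow> bool" where
  "torus_Ck k f \<longleftrightarrow>
     (\<forall>a. \<exists>U F. open U \<and> a \<in> U \<and> Ck_on k F U \<and> (\<forall>x\<in>U. to_torus (F x) = f (to_torus x)))"

definition torus_Ck_diffeomorphism :: "nat \<Rightarrow> (torus \<Rightarrow> torus) \<Rightarrow> bool" where
  "torus_Ck_diffeomorphism k f \<longleftrightarrow> bij f \<and> torus_Ck k f \<and> torus_Ck k (inv f)"

definition torus_smooth_diffeomorphism :: "(torus \<Rightarrow> torus) \<Rightarrow> bool" where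
  "torus_smooth_diffeomorphism f \<longleftrightarrow> (\<forall>k. torus_Ck_diffeomorphism k f)"


section \<open>Conjugacy\<close>

definition C0_conjugate :: "(torus \<Rightarrow> torus) \<Rightarrow> (torus \<Rightarrow> torus) \<Rightarrow> bool" where
  "C0_conjugate T\<^sub>1 T\<^sub>2 \<longleftrightarrow> (\<exists>h g. homeomorphism UNIV UNIV h g \<and> h \<circ> T\<^sub>1 = T\<^sub>2 \<circ> h)"

definition C1_conjugate :: "(torus \<Rightarrow> torus) \<Rightarrow> (torus \<Rightarrow> torus) \<Rightarrow> bool" where
  "C1_conjugate T\<^sub>1 T\<^sub>2 \<longleftrightarrow> (\<exists>h. torus_Ck_diffeomorphism 1 h \<and> h \<circ> T\<^sub>1 = T\<^sub>2 \<circ> h)"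

end

theory Submission
  imports Defs
begin

text \<open>
  Identify the circle \<open>\<real>/\<int>\<close> with the real projective line by \<open>x \<mapsto> tan (\<pi> x)\<close> and let \<open>f\<^sub>l\<close> be the
  circle diffeomorphism \<open>t \<mapsto> l t\<close>. The two diffeomorphisms are \<open>(x, y) \<mapsto> (f\<^sub>l x, y + \<surd>2)\<close> with
  \<open>l = 1/4\<close> and \<open>l = 1/2\<close>. Recurrence is slow because \<open>\<surd>2\<close> is badly approximable. The odd
  extension of \<open>t \<mapsto> \<surd>t\<close> is a homeomorphism conjugating \<open>f\<^sub>1\<^sub>/\<^sub>4\<close> to \<open>f\<^sub>1\<^sub>/\<^sub>2\<close>. A \<open>C\<^sup>1\<close> conjugacy is
  impossible: the first map brings some pairs of points together at the rate \<open>(3/10)\<^sup>n\<close>, whereas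
  the inverse of the second is 2-Lipschitz.
\<close>

section \<open>Product maps on the torus\<close>

text \<open>Expresses that \<open>f\<close> induces a self-map of R/Z; identities between such lifts
  are only needed modulo integers.\<close>

definition circle_lift :: "(real \<Rightarrow> real) \<Rightarrow> bool" where
  "circle_lift f \<longleftrightarrow> (\<forall>a b. a - b \<in> \<int> \<longrightarrow> f a - f b \<in> \<int>)"

text \<open>\<open>rep_torus\<close> picks an arbitrary representative; for a
  \<open>circle_lift\<close> the value does not depend on it.\<close>

definition torus_prod :: "(real \<Rightarrow> real) \<Rightarrow> real \<Rightarrow> torus \<Rightarrow> torus" where
  "torus_prod f b p = to_torus (f (fst (rep_torus p)), snd (rep_torus p) + b)"

lemma to_torus_eqI:
  assumes "fst a - fst b \<in> \<int>" "snd a - snd b \<in> \<int>"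
  shows "to_torus a = to_torus b"
  using assms by (metis to_torus_eq_iff)

lemma torus_prod_to_torus:
  assumes "circle_lift f"
  shows "torus_prod f b (to_torus (x, y)) = to_torus (f x, y + b)"
proof -
  have "to_torus (rep_torus (to_torus (x, y))) = to_torus (x, y)"
    by (metis Quotient_abs_rep Quotient_torus)
  then have "x - fst (rep_torus (to_torus (x, y))) \<in> \<int>" "y - snd (rep_torus (to_torus (x, y))) \<in> \<int>"
    by (simp_all add: to_torus_eq_iff)
  then show ?thesis
    unfolding torus_prod_def using assms
    by (intro sym[OF to_torus_eqI]) (auto simp: circle_lift_def)
qed

lemma torus_prod_funpow:
  assumes "circle_lift f"
  shows "(torus_prod f b ^^ n) (to_torus (x, y)) = to_torus ((f ^^ n) x, y + real n * b)"
  by (induction n) (simp_all add: torus_prod_to_torus[OF assms] algebra_simps)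

lemma torus_cases: obtains x y where "p = to_torus (x, y)"
  by (metis surj_pair to_torus_surj)

lemma torus_prod_comp:
  assumes "circle_lift f" "circle_lift g" "circle_lift f'" "circle_lift g'"
    and "\<And>x. f (g x) - f' (g' x) \<in> \<int>" "b + c = b' + c'"
  shows "torus_prod f b \<circ> torus_prod g c = torus_prod f' b' \<circ> torus_prod g' c'"
proof
  fix p
  show "(torus_prod f b \<circ> torus_prod g c) p = (torus_prod f' b' \<circ> torus_prod g' c') p"
    using assms
    by (cases p rule: torus_cases) (auto simp: torus_prod_to_torus algebra_simps intro!: to_torus_eqI)
qed

lemma torus_prod_id: "torus_prod (\<lambda>x. x) 0 = id"
proof
  fix p
  show "torus_prod (\<lambda>x. x) 0 p = id p"
    by (cases p rule: torus_cases) (simp add: torus_prod_to_torus circle_lift_def)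
qed

lemma torus_prod_inverse:
  assumes "circle_lift f" "circle_lift g" "\<And>x. f (g x) - x \<in> \<int>"
  shows "torus_prod f b \<circ> torus_prod g (- b) = id"
  using torus_prod_comp[of f g "\<lambda>x. x" "\<lambda>x. x" b "- b" 0 0] assms
  by (simp add: torus_prod_id circle_lift_def)

lemma continuous_on_torusI:
  fixes f :: "torus \<Rightarrow> torus"
  assumes "continuous_on UNIV F" "\<And>x. to_torus (F x) = f (to_torus x)"
  shows "continuous_on UNIV f"
proof -
  have "open (f -` B)" if "open B" for B
  proof -
    have "to_torus -` (f -` B) = F -` (to_torus -` B)"
      by (simp add: set_eq_iff assms(2))
    moreover have "open (F -` (to_torus -` B))"
      using assms(1) that by (simp add: open_torus_iff continuous_on_open_vimage)
    ultimately show ?thesis by (simp add: open_torus_iff)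
  qed
  then show ?thesis by (simp add: continuous_on_open_vimage)
qed

lemma continuous_on_torus_prod:
  assumes "circle_lift f" "continuous_on UNIV f"
  shows "continuous_on UNIV (torus_prod f b)"
proof (rule continuous_on_torusI)
  show "continuous_on UNIV (\<lambda>p :: real \<times> real. (f (fst p), snd p + b))"
    by (intro continuous_intros continuous_on_compose2[OF assms(2)]) auto
qed (auto simp: torus_prod_to_torus[OF assms(1)])

text \<open>The second coordinate is only translated, hence 1-Lipschitz; as
  \<open>L \<ge> 1\<close>, the constant \<open>L\<close> serves both coordinates.\<close>

lemma torus_prod_lipschitz:
  assumes f: "circle_lift f" and lip: "\<And>x y. \<bar>f x - f y\<bar> \<le> L * \<bar>x - y\<bar>" and L: "L \<ge> 1"
  shows "dist (torus_prod f b p) (torus_prod f b q) \<le> L * dist p q"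
proof (rule field_le_epsilon)
  fix e :: real assume e: "e > 0"
  obtain x y where p: "p = to_torus (x, y)" by (rule torus_cases)
  \<comment> \<open>The distance is an infimum over representatives; the slack \<open>e / L\<close>
    becomes \<open>e\<close> after multiplication by \<open>L\<close>.\<close>
  obtain w where w: "to_torus w = q" "dist (x, y) w < dist p q + e / L"
    using dist_to_torus_lessE[of "(x, y)" q "dist p q + e / L"] e L p by auto
  obtain u v where uv: "w = (u, v)" by force
  have "dist (torus_prod f b p) (torus_prod f b q) \<le> dist (f x, y + b) (f u, v + b)"
    using w(1) p uv dist_to_torus_le by (metis torus_prod_to_torus[OF f])
  also have "\<dots> = sqrt (\<bar>f x - f u\<bar>\<^sup>2 + (y - v)\<^sup>2)"
    by (simp add: dist_Pair_Pair dist_real_def)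
  also have "\<dots> \<le> sqrt ((L * \<bar>x - u\<bar>)\<^sup>2 + (L * \<bar>y - v\<bar>)\<^sup>2)"
  proof (intro real_sqrt_le_mono add_mono)
    show "\<bar>f x - f u\<bar>\<^sup>2 \<le> (L * \<bar>x - u\<bar>)\<^sup>2" by (intro power_mono lip) simp
    have "1 * \<bar>y - v\<bar> \<le> L * \<bar>y - v\<bar>" using L by (intro mult_right_mono) auto
    then show "(y - v)\<^sup>2 \<le> (L * \<bar>y - v\<bar>)\<^sup>2" by (intro abs_le_square_iff[THEN iffD1]) (use L in auto)
  qed
  also have "\<dots> = sqrt (L\<^sup>2 * ((x - u)\<^sup>2 + (y - v)\<^sup>2))"
    by (simp add: power_mult_distrib algebra_simps)
  also have "\<dots> = L * dist (x, y) (u, v)"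
    using L by (simp add: real_sqrt_mult dist_Pair_Pair dist_real_def)
  also have "\<dots> \<le> L * (dist p q + e / L)"
    using w(2) uv L by (intro mult_left_mono) auto
  also have "\<dots> = L * dist p q + e"
    using L by (simp add: algebra_simps)
  finally show "dist (torus_prod f b p) (torus_prod f b q) \<le> L * dist p q + e" .
qed

section \<open>Slow recurrence\<close>

text \<open>All representatives of \<open>to_torus b\<close> have second coordinate
  \<open>snd b\<close> up to an integer, and a coordinate difference is at most the Euclidean
  distance.\<close>

lemma dist_torus_ge:
  assumes "\<And>m::int. \<bar>snd a - snd b - of_int m\<bar> \<ge> d"
  shows "dist (to_torus a) (to_torus b) \<ge> d"
proof (rule ccontr)
  assume "\<not> d \<le> dist (to_torus a) (to_torus b)"
  then obtain c where c: "to_torus c = to_torus b" "dist a c < d"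
    using dist_to_torus_lessE[of a "to_torus b" d] by auto
  then obtain m where "snd c - snd b = of_int m"
    by (metis Ints_cases to_torus_eq_iff)
  then have "\<bar>snd a - snd c\<bar> \<ge> d" using assms[of m] by (simp add: algebra_simps)
  then show False
    using c(2) dist_snd_le[of a c] by (simp add: dist_real_def)
qed

text \<open>Liouville's argument: \<open>(n sqrt 2 - m)(n sqrt 2 + m) = 2 n^2 - m^2\<close> is a
  nonzero integer, while a counterexample would make the second factor smaller than
  \<open>4 n\<close> and the product smaller than 1.\<close>

lemma sqrt2_badly_approximable:
  fixes n :: nat and m :: int
  assumes "n \<ge> 1"
  shows "\<bar>real n * sqrt 2 - of_int m\<bar> \<ge> 1 / (4 * real n)"
proof (rule ccontr)
  let ?d = "\<bar>real n * sqrt 2 - of_int m\<bar>"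
  assume "\<not> ?d \<ge> 1 / (4 * real n)"
  then have d: "?d < 1 / (4 * real n)" by simp
  also have "\<dots> \<le> 1 / 4" using assms by (simp add: field_simps)
  finally have d1: "?d < 1 / 4" .
  have s: "sqrt 2 < 3 / 2" by (rule real_less_lsqrt) (auto simp: power2_eq_square)
  have "real n * sqrt 2 \<le> real n * (3 / 2)" using s by (intro mult_left_mono) auto
  moreover have "\<bar>real n * sqrt 2 + of_int m\<bar> \<le> 2 * (real n * sqrt 2) + ?d"
    using mult_nonneg_nonneg[OF of_nat_0_le_iff real_sqrt_ge_zero, of 2 n] by linarith
  ultimately have sum: "\<bar>real n * sqrt 2 + of_int m\<bar> < 4 * real n"
    using d1 assms by linarith
  have "?d * \<bar>real n * sqrt 2 + of_int m\<bar> \<le> ?d * (4 * real n)"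
    using sum by (intro mult_left_mono) auto
  also have "\<dots> < 1" using d assms by (simp add: field_simps)
  finally have "?d * \<bar>real n * sqrt 2 + of_int m\<bar> < 1" .
  moreover have "?d * \<bar>real n * sqrt 2 + of_int m\<bar> = \<bar>of_int (2 * int n ^ 2 - m ^ 2)\<bar>"
    by (simp add: abs_mult[symmetric] algebra_simps power2_eq_square)
  ultimately have "\<bar>2 * int n ^ 2 - m ^ 2\<bar> < 1" by linarith
  then have eq: "m ^ 2 = 2 * int n ^ 2" by linarith
  have "m \<noteq> 0" using eq assms by auto
  \<comment> \<open>Irrationality of sqrt 2: the exponent of 2 is even in \<open>m^2\<close> and odd
    in \<open>2 n^2\<close>.\<close>
  then have "multiplicity 2 (m ^ 2) = 2 * multiplicity 2 m"
    by (simp add: prime_elem_multiplicity_power_distrib)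
  moreover have "multiplicity 2 (2 * int n ^ 2) = Suc (2 * multiplicity 2 (int n))"
    using assms by (simp add: prime_elem_multiplicity_mult_distrib prime_elem_multiplicity_power_distrib)
  ultimately show False using eq by (metis double_not_eq_Suc_double)
qed

lemma torus_prod_slow_recurrence:
  assumes "circle_lift f" "n \<ge> 1"
  shows "dist ((torus_prod f (sqrt 2) ^^ n) p) p \<ge> 1/4 * real n powr (- 1)"
proof (cases p rule: torus_cases)
  case (1 x y)
  have "dist (to_torus ((f ^^ n) x, y + real n * sqrt 2)) (to_torus (x, y)) \<ge> 1 / (4 * real n)"
    using sqrt2_badly_approximable[OF assms(2)] by (intro dist_torus_ge) auto
  then show ?thesis
    using 1 assms by (simp add: torus_prod_funpow powr_minus field_simps)
qed

section \<open>Circle maps induced by maps of the plane\<close>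

text \<open>
  The circle is the projective line: \<open>x\<close> stands for the line spanned by \<open>(cos (\<pi> x), sin (\<pi> x))\<close>.
  The following function lifts the action of \<open>(c, s) \<mapsto> (\<phi> c, \<psi> s)\<close> on lines. Its arctangent is the
  oriented angle between a vector and its image, which lie in the same quadrant.
\<close>
definition ang_lift :: "(real \<Rightarrow> real) \<Rightarrow> (real \<Rightarrow> real) \<Rightarrow> real \<Rightarrow> real" where
  "ang_lift \<phi> \<psi> x = x + arctan
     ((\<psi> (sin (pi * x)) * cos (pi * x) - \<phi> (cos (pi * x)) * sin (pi * x)) /
      (\<phi> (cos (pi * x)) * cos (pi * x) + \<psi> (sin (pi * x)) * sin (pi * x))) / pi"

text \<open>Keeping signs makes the angle between a nonzero vector and its image acute; oddness
  sends opposite vectors to opposite vectors, so there is an induced map on lines.\<close>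

definition odd_sgn :: "(real \<Rightarrow> real) \<Rightarrow> bool" where
  "odd_sgn \<phi> \<longleftrightarrow> (\<forall>t. sgn (\<phi> t) = sgn t \<and> \<phi> (- t) = - \<phi> t)"

lemma odd_sgn_mult_pos: "odd_sgn \<phi> \<Longrightarrow> t \<noteq> 0 \<Longrightarrow> \<phi> t * t > 0"
  unfolding odd_sgn_def sgn_1_pos[symmetric] sgn_mult
  by (cases t "0 :: real" rule: linorder_cases) auto

lemma odd_sgn_mult_nonneg: "odd_sgn \<phi> \<Longrightarrow> \<phi> t * t \<ge> 0"
  using odd_sgn_mult_pos[of \<phi> t] by (cases "t = 0") auto

lemma odd_sgn_dot_pos:
  assumes "odd_sgn \<phi>" "odd_sgn \<psi>"
  shows "\<phi> (cos x) * cos x + \<psi> (sin x) * sin x > 0"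
proof (cases "cos x = 0")
  case True
  then have "sin x \<noteq> 0" using sin_cos_squared_add[of x] by auto
  then show ?thesis
    using odd_sgn_mult_pos[OF assms(2)] odd_sgn_mult_nonneg[OF assms(1)] by (simp add: add_nonneg_pos)
next
  case False
  then show ?thesis
    using odd_sgn_mult_pos[OF assms(1)] odd_sgn_mult_nonneg[OF assms(2)] by (simp add: add_pos_nonneg)
qed

text \<open>\<open>d\<close> and \<open>m\<close> are the dot and cross product of the unit vector
  with its image. If the image has length \<open>r\<close> and lies at angle \<open>a\<close> from
  it, then \<open>d = r cos a\<close> and \<open>m = r sin a\<close>, and rotating by
  \<open>a\<close> and scaling by \<open>r\<close> recovers the image.\<close>

lemma ang_lift_direction:
  assumes "odd_sgn \<phi>" "odd_sgn \<psi>"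
  obtains r where "r > 0" "\<phi> (cos (pi * x)) = r * cos (pi * ang_lift \<phi> \<psi> x)"
    "\<psi> (sin (pi * x)) = r * sin (pi * ang_lift \<phi> \<psi> x)"
proof -
  let ?C = "cos (pi * x)" and ?S = "sin (pi * x)"
  define d where "d = \<phi> ?C * ?C + \<psi> ?S * ?S"
  define m where "m = \<psi> ?S * ?C - \<phi> ?C * ?S"
  define a where "a = arctan (m / d)"
  have d: "d > 0" unfolding d_def by (rule odd_sgn_dot_pos[OF assms])
  have c: "cos a > 0" by (simp add: a_def cos_arctan add_pos_nonneg)
  have "sin a = tan a * cos a" using c by (simp add: tan_def)
  then have sa: "sin a = m / d * cos a" by (simp add: a_def tan_arctan)
  have L: "pi * ang_lift \<phi> \<psi> x = pi * x + a"
    by (simp add: ang_lift_def a_def m_def d_def algebra_simps)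
  have one: "?C * ?C + ?S * ?S = 1" using sin_cos_squared_add2[of "pi * x"] by (simp add: power2_eq_square)
  have "d / cos a * cos (pi * x + a) = d * ?C - m * ?S"
    using d c by (simp add: cos_add sa field_simps)
  also have "\<dots> = \<phi> ?C * (?C * ?C + ?S * ?S)"
    unfolding d_def m_def by algebra
  also have "\<dots> = \<phi> ?C" by (simp only: one mult_1_right)
  finally have 1: "d / cos a * cos (pi * x + a) = \<phi> ?C" .
  have "d / cos a * sin (pi * x + a) = d * ?S + m * ?C"
    using d c by (simp add: sin_add sa field_simps)
  also have "\<dots> = \<psi> ?S * (?C * ?C + ?S * ?S)"
    unfolding d_def m_def by algebra
  also have "\<dots> = \<psi> ?S" by (simp only: one mult_1_right)
  finally have 2: "d / cos a * sin (pi * x + a) = \<psi> ?S" .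
  show thesis using that[of "d / cos a"] d c unfolding L 1 2 by simp
qed

lemma diff_Ints_iff_parallel:
  fixes a b :: real
  shows "a - b \<in> \<int> \<longleftrightarrow> cos (pi * a) * sin (pi * b) = sin (pi * a) * cos (pi * b)"
proof -
  have "a - b \<in> \<int> \<longleftrightarrow> sin (pi * a - pi * b) = 0"
    using sin_times_pi_eq_0[of "a - b"] by (simp add: algebra_simps)
  then show ?thesis by (auto simp: sin_diff)
qed

lemma diff_Ints_cos_sin:
  fixes a b :: real
  assumes "a - b \<in> \<int>"
  obtains "cos (pi * a) = cos (pi * b)" "sin (pi * a) = sin (pi * b)"
  | "cos (pi * a) = - cos (pi * b)" "sin (pi * a) = - sin (pi * b)"
proof -
  have s: "sin (pi * (a - b)) = 0"
    using assms sin_times_pi_eq_0[of "a - b"] by (simp add: mult.commute)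
  then have "cos (pi * (a - b)) = 1 \<or> cos (pi * (a - b)) = - 1"
    using sin_cos_squared_add[of "pi * (a - b)"] by (simp add: power2_eq_1_iff)
  moreover have "cos (pi * a) = cos (pi * (a - b)) * cos (pi * b)"
    "sin (pi * a) = cos (pi * (a - b)) * sin (pi * b)"
    using s cos_add[of "pi * (a - b)" "pi * b"] sin_add[of "pi * (a - b)" "pi * b"]
    by (simp_all add: algebra_simps)
  ultimately show thesis using that by auto
qed

text \<open>The factor \<open>r > 0\<close> cancels, so claims about \<open>ang_lift\<close> modulo
  integers become equations between homogeneous coordinates, free of arctangents.\<close>

lemma ang_lift_diff_Ints_iff:
  assumes "odd_sgn \<phi>" "odd_sgn \<psi>"
  shows "ang_lift \<phi> \<psi> a - b \<in> \<int> \<longleftrightarrow> \<phi> (cos (pi * a)) * sin (pi * b) = \<psi> (sin (pi * a)) * cos (pi * b)"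
proof -
  obtain r where "r > 0" "\<phi> (cos (pi * a)) = r * cos (pi * ang_lift \<phi> \<psi> a)"
    "\<psi> (sin (pi * a)) = r * sin (pi * ang_lift \<phi> \<psi> a)"
    using ang_lift_direction[OF assms] by blast
  then show ?thesis by (simp add: diff_Ints_iff_parallel mult.assoc)
qed

lemma ang_lift_eqI:
  assumes "odd_sgn \<phi>" "odd_sgn \<psi>" "odd_sgn \<phi>'" "odd_sgn \<psi>'"
    and "\<phi> (cos (pi * a)) * \<psi>' (sin (pi * b)) = \<psi> (sin (pi * a)) * \<phi>' (cos (pi * b))"
  shows "ang_lift \<phi> \<psi> a - ang_lift \<phi>' \<psi>' b \<in> \<int>"
proof -
  obtain r where "r > 0" "\<phi>' (cos (pi * b)) = r * cos (pi * ang_lift \<phi>' \<psi>' b)"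
    "\<psi>' (sin (pi * b)) = r * sin (pi * ang_lift \<phi>' \<psi>' b)"
    using ang_lift_direction[OF assms(3,4)] by blast
  with assms show ?thesis by (simp add: ang_lift_diff_Ints_iff)
qed

lemma circle_lift_ang_lift:
  assumes "odd_sgn \<phi>" "odd_sgn \<psi>"
  shows "circle_lift (ang_lift \<phi> \<psi>)"
  unfolding circle_lift_def
proof (intro allI impI)
  fix a b :: real
  assume "a - b \<in> \<int>"
  then show "ang_lift \<phi> \<psi> a - ang_lift \<phi> \<psi> b \<in> \<int>"
    by (cases rule: diff_Ints_cos_sin; intro ang_lift_eqI assms)
       (use assms in \<open>simp_all add: odd_sgn_def mult.commute\<close>)
qed

lemma continuous_on_ang_lift:
  assumes "odd_sgn \<phi>" "odd_sgn \<psi>" "continuous_on UNIV \<phi>" "continuous_on UNIV \<psi>"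
  shows "continuous_on UNIV (ang_lift \<phi> \<psi>)"
proof -
  have cos: "continuous_on UNIV (\<lambda>x. \<phi> (cos (pi * x)))"
    by (rule continuous_on_compose2[OF assms(3)]) (auto intro!: continuous_intros)
  have sin: "continuous_on UNIV (\<lambda>x. \<psi> (sin (pi * x)))"
    by (rule continuous_on_compose2[OF assms(4)]) (auto intro!: continuous_intros)
  have "\<phi> (cos x) * cos x + \<psi> (sin x) * sin x \<noteq> 0" for x
    using odd_sgn_dot_pos[OF assms(1,2), of x] by simp
  then show ?thesis
    unfolding ang_lift_def by (intro continuous_intros cos sin) auto
qed

section \<open>The hyperbolic circle maps\<close>

text \<open>This lifts \<open>tan (\<pi> x) \<mapsto> l tan (\<pi> x)\<close>, with fixed points \<open>0\<close> and \<open>1/2\<close> of multipliers \<open>l\<close> and \<open>1/l\<close>.\<close>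
definition proj_map :: "real \<Rightarrow> real \<Rightarrow> real" where
  "proj_map l = ang_lift (\<lambda>t. t) (\<lambda>t. l * t)"

lemma odd_sgn_scale: "l > 0 \<Longrightarrow> odd_sgn (\<lambda>t. l * t)"
  by (simp add: odd_sgn_def sgn_mult)

lemma odd_sgn_ident: "odd_sgn (\<lambda>t. t)"
  by (simp add: odd_sgn_def)

text \<open>On negative numbers, \<^const>\<open>sqrt\<close> is the odd extension.\<close>
lemma odd_sgn_sqrt: "odd_sgn sqrt"
  by (simp add: odd_sgn_def real_sqrt_minus sgn_real_def)

lemma odd_sgn_square: "odd_sgn (\<lambda>t. t * \<bar>t\<bar>)"
  by (simp add: odd_sgn_def sgn_mult sgn_real_def)

lemma circle_lift_proj_map: "l > 0 \<Longrightarrow> circle_lift (proj_map l)"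
  unfolding proj_map_def by (intro circle_lift_ang_lift odd_sgn_ident odd_sgn_scale)

lemma proj_map_0: "proj_map l 0 = 0"
  by (simp add: proj_map_def ang_lift_def)

lemma proj_map_inverse:
  assumes "l > 0"
  shows "proj_map l (proj_map (1 / l) x) - x \<in> \<int>"
proof -
  obtain r where r: "r > 0" "cos (pi * x) = r * cos (pi * proj_map (1 / l) x)"
    "1 / l * sin (pi * x) = r * sin (pi * proj_map (1 / l) x)"
    using ang_lift_direction[OF odd_sgn_ident odd_sgn_scale, of "1 / l" x] assms
    unfolding proj_map_def by (metis zero_less_divide_1_iff)
  have "sin (pi * x) = r * (l * sin (pi * proj_map (1 / l) x))"
    using r(3) assms by (simp add: field_simps)
  then show ?thesis
    unfolding proj_map_def[of l] ang_lift_diff_Ints_iff[OF odd_sgn_ident odd_sgn_scale[OF assms]] r(2)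
    by simp
qed

lemma proj_map_denom_pos:
  fixes x l :: real
  assumes "l > 0"
  shows "(cos x)\<^sup>2 + l\<^sup>2 * (sin x)\<^sup>2 > 0"
  using odd_sgn_dot_pos[OF odd_sgn_ident odd_sgn_scale[of "l\<^sup>2"], of x] assms
  by (simp add: power2_eq_square mult.assoc)

text \<open>The unit vector \<open>(C, S)\<close> goes to \<open>(C, l * S)\<close>, of squared
  length \<open>E\<close>; its angle turns at the rate determinant over squared length,
  \<open>l / E\<close>.\<close>

lemma DERIV_proj_map:
  assumes l: "l > 0"
  shows "(proj_map l has_real_derivative l / ((cos (pi * x))\<^sup>2 + l\<^sup>2 * (sin (pi * x))\<^sup>2)) (at x)"
proof -
  define C where "C = cos (pi * x)"
  define S where "S = sin (pi * x)"
  define N where "N = l * S * C - C * S"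
  define D where "D = C * C + l * S * S"
  define E where "E = C\<^sup>2 + l\<^sup>2 * S\<^sup>2"
  have one: "C\<^sup>2 + S\<^sup>2 = 1" by (simp add: C_def S_def)
  have D: "D > 0"
    using odd_sgn_dot_pos[OF odd_sgn_ident odd_sgn_scale[OF l], of "pi * x"] by (simp add: D_def C_def S_def)
  have E: "E > 0" using proj_map_denom_pos[OF l] by (simp add: E_def C_def S_def)
  have dN: "((\<lambda>x. l * sin (pi * x) * cos (pi * x) - cos (pi * x) * sin (pi * x))
      has_real_derivative pi * (l - 1) * (C\<^sup>2 - S\<^sup>2)) (at x)"
    by (auto intro!: derivative_eq_intros simp: C_def S_def power2_eq_square algebra_simps)
  have dD: "((\<lambda>x. cos (pi * x) * cos (pi * x) + l * sin (pi * x) * sin (pi * x))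
      has_real_derivative 2 * pi * (l - 1) * S * C) (at x)"
    by (auto intro!: derivative_eq_intros simp: C_def S_def power2_eq_square algebra_simps)
  have DN: "D\<^sup>2 + N\<^sup>2 = E"
  proof -
    \<comment> \<open>Lagrange's identity for the dot product \<open>D\<close> and cross product
      \<open>N\<close> of \<open>(C, S)\<close> and \<open>(C, l * S)\<close>.\<close>
    have "D\<^sup>2 + N\<^sup>2 = E * (C\<^sup>2 + S\<^sup>2)" unfolding D_def N_def E_def by algebra
    then show ?thesis by (simp add: one)
  qed
  have num: "pi * (l - 1) * (C\<^sup>2 - S\<^sup>2) * D - N * (2 * pi * (l - 1) * S * C) = pi * (l - 1) * (C\<^sup>2 - l * S\<^sup>2)"
  proof -
    \<comment> \<open>The extra factor \<open>C\<^sup>2 + S\<^sup>2\<close>, equal to 1, makes both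
      sides homogeneous of degree 4 in \<open>C\<close> and \<open>S\<close>, hence a polynomial
      identity.\<close>
    have "pi * (l - 1) * (C\<^sup>2 - S\<^sup>2) * D - N * (2 * pi * (l - 1) * S * C)
        = pi * (l - 1) * (C\<^sup>2 - l * S\<^sup>2) * (C\<^sup>2 + S\<^sup>2)"
      unfolding D_def N_def by algebra
    then show ?thesis by (simp add: one)
  qed
  have "((\<lambda>x. x + arctan ((l * sin (pi * x) * cos (pi * x) - cos (pi * x) * sin (pi * x)) /
        (cos (pi * x) * cos (pi * x) + l * sin (pi * x) * sin (pi * x))) / pi)
      has_real_derivative 1 + inverse (1 + (N / D)\<^sup>2) *
        ((pi * (l - 1) * (C\<^sup>2 - S\<^sup>2) * D - N * (2 * pi * (l - 1) * S * C)) / (D * D)) / pi) (at x)"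
    unfolding N_def D_def S_def C_def
    using D[unfolded D_def S_def C_def]
    by (intro DERIV_add DERIV_ident DERIV_cdivide DERIV_chain2[OF DERIV_arctan]
        DERIV_divide dN[unfolded S_def C_def] dD[unfolded S_def C_def]) simp
  also have "1 + inverse (1 + (N / D)\<^sup>2) *
      ((pi * (l - 1) * (C\<^sup>2 - S\<^sup>2) * D - N * (2 * pi * (l - 1) * S * C)) / (D * D)) / pi = l / E"
  proof -
    have "1 + (N / D)\<^sup>2 = E / D\<^sup>2" using D DN by (simp add: field_simps)
    then have "1 + inverse (1 + (N / D)\<^sup>2) *
        ((pi * (l - 1) * (C\<^sup>2 - S\<^sup>2) * D - N * (2 * pi * (l - 1) * S * C)) / (D * D)) / pi
        = 1 + (l - 1) * (C\<^sup>2 - l * S\<^sup>2) / E"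
      unfolding num using D by (simp add: power2_eq_square)
    also have "\<dots> = (E + (l - 1) * (C\<^sup>2 - l * S\<^sup>2)) / E"
      using E by (simp add: add_divide_distrib)
    also have "E + (l - 1) * (C\<^sup>2 - l * S\<^sup>2) = l * (C\<^sup>2 + S\<^sup>2)"
      unfolding E_def by algebra
    finally show ?thesis by (simp add: one)
  qed
  finally show ?thesis
    unfolding proj_map_def ang_lift_def E_def S_def C_def by simp
qed

text \<open>For \<open>l \<ge> 1\<close> the denominator of the derivative is at least
  \<open>cos^2 + sin^2 = 1\<close>, so the derivative is at most \<open>l\<close>.\<close>

lemma proj_map_lipschitz:
  assumes "l \<ge> 1"
  shows "\<bar>proj_map l x - proj_map l y\<bar> \<le> l * \<bar>x - y\<bar>"
proof -
  have "norm (l / ((cos (pi * x))\<^sup>2 + l\<^sup>2 * (sin (pi * x))\<^sup>2)) \<le> l" for x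
  proof -
    have "1 * (sin (pi * x))\<^sup>2 \<le> l\<^sup>2 * (sin (pi * x))\<^sup>2"
      using assms by (intro mult_right_mono) auto
    then have ge: "(cos (pi * x))\<^sup>2 + l\<^sup>2 * (sin (pi * x))\<^sup>2 \<ge> 1"
      using sin_cos_squared_add[of "pi * x"] by linarith
    then have "l * 1 \<le> l * ((cos (pi * x))\<^sup>2 + l\<^sup>2 * (sin (pi * x))\<^sup>2)"
      using assms by (intro mult_left_mono) auto
    then show ?thesis using ge assms by (simp add: divide_le_eq)
  qed
  then have "norm (proj_map l x - proj_map l y) \<le> l * norm (x - y)"
    using assms by (intro field_differentiable_bound[of UNIV "proj_map l"
        "\<lambda>x. l / ((cos (pi * x))\<^sup>2 + l\<^sup>2 * (sin (pi * x))\<^sup>2)"] DERIV_proj_map) auto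
  then show ?thesis by simp
qed

lemma proj_map_contraction:
  assumes "0 < l" "l < c"
  obtains e where "e > 0" "\<And>x. \<bar>x\<bar> < e \<Longrightarrow> \<bar>proj_map l x\<bar> \<le> c * \<bar>x\<bar>"
proof -
  have "((\<lambda>y. proj_map l y / y) \<longlongrightarrow> l) (at 0)"
    using DERIV_proj_map[OF assms(1), of 0] by (simp add: has_field_derivative_iff proj_map_0)
  from tendstoD[OF this, of "c - l"] obtain e where e: "e > 0"
    "\<And>x. x \<noteq> 0 \<Longrightarrow> \<bar>x\<bar> < e \<Longrightarrow> \<bar>proj_map l x / x - l\<bar> < c - l"
    using assms by (auto simp: eventually_at dist_real_def)
  have "\<bar>proj_map l x\<bar> \<le> c * \<bar>x\<bar>" if "\<bar>x\<bar> < e" for x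
  proof (cases "x = 0")
    case False
    then have "\<bar>proj_map l x / x\<bar> \<le> c" using e(2)[OF False that] assms by linarith
    then show ?thesis using False by (simp add: abs_divide divide_le_eq)
  qed (simp add: proj_map_0)
  with e(1) show thesis by (rule that)
qed

section \<open>Smoothness\<close>

text \<open>An algebra that contains the derivative of \<^term>\<open>proj_map l\<close> and is closed under differentiation.\<close>
inductive trig_alg :: "real \<Rightarrow> (real \<Rightarrow> real) \<Rightarrow> bool" for l where
  const: "trig_alg l (\<lambda>x. c)"
| sin: "trig_alg l (\<lambda>x. sin (pi * x))"
| cos: "trig_alg l (\<lambda>x. cos (pi * x))"
| recip: "trig_alg l (\<lambda>x. 1 / ((cos (pi * x))\<^sup>2 + l\<^sup>2 * (sin (pi * x))\<^sup>2))"
| add: "trig_alg l f \<Longrightarrow> trig_alg l g \<Longrightarrow> trig_alg l (\<lambda>x. f x + g x)"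
| mult: "trig_alg l f \<Longrightarrow> trig_alg l g \<Longrightarrow> trig_alg l (\<lambda>x. f x * g x)"

lemma trig_alg_deriv:
  assumes "trig_alg l f" "l > 0"
  shows "\<exists>g. trig_alg l g \<and> (\<forall>x. (f has_real_derivative g x) (at x))"
  using assms(1)
proof induction
  case (const c)
  show ?case by (rule exI[of _ "\<lambda>x. 0"]) (auto intro: trig_alg.const)
next
  case sin
  show ?case
    by (rule exI[of _ "\<lambda>x. pi * cos (pi * x)"])
       (auto intro!: trig_alg.const trig_alg.cos trig_alg.mult derivative_eq_intros)
next
  case cos
  show ?case
    by (rule exI[of _ "\<lambda>x. (- pi) * sin (pi * x)"])
       (intro conjI trig_alg.const trig_alg.sin trig_alg.mult allI, auto intro!: derivative_eq_intros)
next
  case recip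
  let ?r = "\<lambda>x. 1 / ((cos (pi * x))\<^sup>2 + l\<^sup>2 * (sin (pi * x))\<^sup>2)"
  \<comment> \<open>With \<open>E\<close> the denominator,
    \<open>E' = 2 pi (l^2 - 1) sin cos\<close>, and \<open>- E' / E^2\<close> is written as a
    product of generators.\<close>
  have "(?r has_real_derivative (2 * pi * (1 - l\<^sup>2)) * (sin (pi * x) * (cos (pi * x) * (?r x * ?r x)))) (at x)" for x
    using proj_map_denom_pos[OF assms(2), of "pi * x"]
    by (auto intro!: derivative_eq_intros simp: power2_eq_square algebra_simps diff_divide_distrib)
  then show ?case
    by (intro exI[of _ "\<lambda>x. (2 * pi * (1 - l\<^sup>2)) * (sin (pi * x) * (cos (pi * x) * (?r x * ?r x)))"] conjI allI
        trig_alg.intros)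
next
  case (add f g)
  then obtain f' g' where "trig_alg l f'" "trig_alg l g'"
    "\<And>x. (f has_real_derivative f' x) (at x)" "\<And>x. (g has_real_derivative g' x) (at x)" by blast
  then show ?case
    by (intro exI[of _ "\<lambda>x. f' x + g' x"] conjI allI trig_alg.intros DERIV_add)
next
  case (mult f g)
  then obtain f' g' where "trig_alg l f'" "trig_alg l g'"
    "\<And>x. (f has_real_derivative f' x) (at x)" "\<And>x. (g has_real_derivative g' x) (at x)" by blast
  with mult.hyps show ?case
    by (intro exI[of _ "\<lambda>x. f' x * g x + g' x * f x"] conjI allI trig_alg.intros DERIV_mult)
qed

lemma has_derivative_fst_comp:
  fixes f :: "real \<Rightarrow> real" and L :: "real \<times> real \<Rightarrow> real"
  assumes "\<And>x. (f has_real_derivative g x) (at x)" "bounded_linear L"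
  shows "((\<lambda>p. (a * f (fst p), L p + b)) has_derivative (\<lambda>v. (a * fst v * g (fst p), L v))) (at p)"
proof -
  have "((\<lambda>p. f (fst p)) has_derivative (\<lambda>v. g (fst p) * fst v)) (at p)"
    using has_derivative_compose[OF has_derivative_fst[OF has_derivative_ident] assms(1)[of "fst p", unfolded has_field_derivative_def]]
    by simp
  moreover have "(L has_derivative L) (at p)"
    using assms(2) by (rule bounded_linear_imp_has_derivative)
  ultimately show ?thesis
    by (auto intro!: derivative_eq_intros)
qed

text \<open>A derivative along \<open>v\<close> has the same form, with \<open>f\<close> replaced by
  its derivative, \<open>a\<close> by \<open>a * fst v\<close> and \<open>b\<close> by 0; hence the
  induction with all three arbitrary.\<close>

lemma Ck_on_trig_alg:
  fixes a b :: real
  assumes "l > 0"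
  shows "trig_alg l f \<Longrightarrow> Ck_on k (\<lambda>p :: real \<times> real. (a * f (fst p), b)) UNIV"
proof (induction k arbitrary: f a b)
  case 0
  then obtain g where "\<And>x. (f has_real_derivative g x) (at x)"
    using trig_alg_deriv[OF _ assms] by blast
  from has_derivative_fst_comp[OF this bounded_linear_zero, of a b]
  have "continuous_on UNIV (\<lambda>p :: real \<times> real. (a * f (fst p), 0 + b))"
    by (rule has_derivative_continuous_on)
  then show ?case by simp
next
  case (Suc k)
  then obtain g where g: "trig_alg l g" "\<And>x. (f has_real_derivative g x) (at x)"
    using trig_alg_deriv[OF _ assms] by blast
  have D: "((\<lambda>p :: real \<times> real. (a * f (fst p), b)) has_derivative (\<lambda>v. (a * fst v * g (fst p), 0))) (at p)" for p
    using has_derivative_fst_comp[OF g(2) bounded_linear_zero] by simp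
  show ?case
    using Suc.IH[OF g(1)] differentiableI[OF D]
    by (simp add: frechet_derivative_at[OF D, symmetric])
qed

text \<open>The algebra is known to contain the derivative of the lift, so the first differentiation
  is done separately. The single lift \<open>F\<close> on the whole plane serves at every
  point.\<close>

lemma torus_Ck_torus_prod:
  assumes "l > 0"
  shows "torus_Ck k (torus_prod (proj_map l) b)"
proof -
  define F where "F = (\<lambda>p. (proj_map l (fst p), snd p + b))"
  define g where "g = (\<lambda>x. l * (1 / ((cos (pi * x))\<^sup>2 + l\<^sup>2 * (sin (pi * x))\<^sup>2)))"
  have g: "trig_alg l g" unfolding g_def by (intro trig_alg.intros)
  have "(proj_map l has_real_derivative g x) (at x)" for x
    using DERIV_proj_map[OF assms] by (simp add: g_def)
  from has_derivative_fst_comp[OF this bounded_linear_snd, of 1]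
  have D: "(F has_derivative (\<lambda>v. (fst v * g (fst p), snd v))) (at p)" for p
    by (simp add: F_def)
  have "Ck_on k F UNIV"
  proof (cases k)
    case 0
    then show ?thesis using has_derivative_continuous_on[of UNIV, OF D] by simp
  next
    case (Suc j)
    then show ?thesis
      using Ck_on_trig_alg[OF assms g] differentiableI[OF D]
      by (simp add: frechet_derivative_at[OF D, symmetric])
  qed
  moreover have "to_torus (F p) = torus_prod (proj_map l) b (to_torus p)" for p
    using torus_prod_to_torus[OF circle_lift_proj_map[OF assms], of b "fst p" "snd p"] by (simp add: F_def)
  ultimately show ?thesis
    unfolding torus_Ck_def by (intro allI exI[of _ UNIV] exI[of _ F]) auto
qed

lemma torus_prod_proj_map_inverse:
  assumes "l > 0"
  shows "torus_prod (proj_map l) b \<circ> torus_prod (proj_map (1 / l)) (- b) = id"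
  using assms by (intro torus_prod_inverse circle_lift_proj_map proj_map_inverse) auto

lemma torus_prod_proj_map_inverse':
  assumes "l > 0"
  shows "torus_prod (proj_map (1 / l)) (- b) \<circ> torus_prod (proj_map l) b = id"
  using torus_prod_proj_map_inverse[of "1 / l" "- b"] assms by simp

lemma torus_smooth_diffeomorphism_torus_prod:
  assumes "l > 0"
  shows "torus_smooth_diffeomorphism (torus_prod (proj_map l) b)"
  using torus_Ck_torus_prod[of l] torus_Ck_torus_prod[of "1 / l"] assms
    o_bij[OF torus_prod_proj_map_inverse' torus_prod_proj_map_inverse]
    inv_unique_comp[OF torus_prod_proj_map_inverse torus_prod_proj_map_inverse']
  unfolding torus_smooth_diffeomorphism_def torus_Ck_diffeomorphism_def by simp

section \<open>The topological conjugacy\<close>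

text \<open>In the coordinate \<open>t = tan (pi x)\<close> the conjugacy equation is
  \<open>sqrt (l^2 t) = l sqrt t\<close>. \<open>?K\<close> and \<open>?K'\<close> apply the signed
  root and signed square to both homogeneous coordinates.\<close>

lemma proj_map_C0_conjugate:
  assumes "l > 0"
  shows "C0_conjugate (torus_prod (proj_map (l\<^sup>2)) b) (torus_prod (proj_map l) b)"
proof -
  let ?K = "ang_lift sqrt sqrt" and ?K' = "ang_lift (\<lambda>t. t * \<bar>t\<bar>) (\<lambda>t. t * \<bar>t\<bar>)"
  let ?h = "torus_prod ?K 0" and ?g = "torus_prod ?K' 0"
  have K: "circle_lift ?K" by (intro circle_lift_ang_lift odd_sgn_sqrt)
  have K': "circle_lift ?K'" by (intro circle_lift_ang_lift odd_sgn_square)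
  have l2: "l\<^sup>2 > 0" using assms by simp
  have KK': "?K (?K' x) - x \<in> \<int>" for x
  proof -
    obtain r where r: "r > 0" "cos (pi * x) * \<bar>cos (pi * x)\<bar> = r * cos (pi * ?K' x)"
      "sin (pi * x) * \<bar>sin (pi * x)\<bar> = r * sin (pi * ?K' x)"
      using ang_lift_direction[OF odd_sgn_square odd_sgn_square, of x] by blast
    have root: "sqrt (t * \<bar>t\<bar>) = t" for t
      by (cases "t \<ge> 0") (auto simp: real_sqrt_mult real_sqrt_minus abs_if)
    \<comment> \<open>The signed square root is multiplicative on all of R, so the scale factor
      comes out as \<open>sqrt r\<close>.\<close>
    have "cos (pi * x) = sqrt r * sqrt (cos (pi * ?K' x))" "sin (pi * x) = sqrt r * sqrt (sin (pi * ?K' x))"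
      using r(2,3) by (metis real_sqrt_mult root)+
    then show ?thesis by (simp add: ang_lift_diff_Ints_iff[OF odd_sgn_sqrt odd_sgn_sqrt])
  qed
  have K'K: "?K' (?K x) - x \<in> \<int>" for x
  proof -
    obtain r where r: "r > 0" "sqrt (cos (pi * x)) = r * cos (pi * ?K x)"
      "sqrt (sin (pi * x)) = r * sin (pi * ?K x)"
      using ang_lift_direction[OF odd_sgn_sqrt odd_sgn_sqrt, of x] by blast
    have sq: "sqrt t * \<bar>sqrt t\<bar> = t" for t
      by (cases "t \<ge> 0") (auto simp: real_sqrt_minus abs_if)
    have "cos (pi * x) = r\<^sup>2 * (cos (pi * ?K x) * \<bar>cos (pi * ?K x)\<bar>)"
      "sin (pi * x) = r\<^sup>2 * (sin (pi * ?K x) * \<bar>sin (pi * ?K x)\<bar>)"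
      using sq[of "cos (pi * x)"] sq[of "sin (pi * x)"] r(1) unfolding r(2,3)
      by (simp_all add: abs_mult power2_eq_square mult_ac)
    then show ?thesis by (simp add: ang_lift_diff_Ints_iff[OF odd_sgn_square odd_sgn_square])
  qed
  have conj: "?K (proj_map (l\<^sup>2) x) - proj_map l (?K x) \<in> \<int>" for x
  proof -
    obtain r where r: "r > 0" "cos (pi * x) = r * cos (pi * proj_map (l\<^sup>2) x)"
      "l\<^sup>2 * sin (pi * x) = r * sin (pi * proj_map (l\<^sup>2) x)"
      using ang_lift_direction[OF odd_sgn_ident odd_sgn_scale[OF l2], of x]
      unfolding proj_map_def by blast
    obtain s where s: "s > 0" "sqrt (cos (pi * x)) = s * cos (pi * ?K x)"
      "sqrt (sin (pi * x)) = s * sin (pi * ?K x)"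
      using ang_lift_direction[OF odd_sgn_sqrt odd_sgn_sqrt, of x] by blast
    have "sqrt r * sqrt (cos (pi * proj_map (l\<^sup>2) x)) = s * cos (pi * ?K x)"
      using s(2) unfolding r(2) by (simp add: real_sqrt_mult)
    moreover have "sqrt r * sqrt (sin (pi * proj_map (l\<^sup>2) x)) = l * (s * sin (pi * ?K x))"
      using r(3) s(3) assms by (metis real_sqrt_mult real_sqrt_pow2_iff real_sqrt_abs abs_of_pos)
    \<comment> \<open>The rooted image of \<open>x\<close> is proportional to
      \<open>(cos, l sin)\<close> at \<open>?K x\<close>, the vector whose direction defines
      \<open>proj_map l\<close> there.\<close>
    ultimately have c: "sqrt (cos (pi * proj_map (l\<^sup>2) x)) = s / sqrt r * cos (pi * ?K x)"
      "sqrt (sin (pi * proj_map (l\<^sup>2) x)) = s / sqrt r * (l * sin (pi * ?K x))"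
      using r(1) by (simp_all add: field_simps)
    show ?thesis
      unfolding proj_map_def[of l]
      by (rule ang_lift_eqI[OF odd_sgn_sqrt odd_sgn_sqrt odd_sgn_ident odd_sgn_scale[OF assms]])
         (simp add: c)
  qed
  have "homeomorphism UNIV UNIV ?h ?g"
    unfolding homeomorphism_def
    using torus_prod_inverse[OF K K' KK', of 0] torus_prod_inverse[OF K' K K'K, of 0]
    by (auto simp: fun_eq_iff image_iff intro!: continuous_on_torus_prod continuous_on_ang_lift K K'
        odd_sgn_sqrt odd_sgn_square continuous_intros) metis+
  moreover have "?h \<circ> torus_prod (proj_map (l\<^sup>2)) b = torus_prod (proj_map l) b \<circ> ?h"
    using assms by (intro torus_prod_comp circle_lift_proj_map K conj) auto
  ultimately show ?thesis unfolding C0_conjugate_def by blast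
qed

section \<open>The obstruction to a differentiable conjugacy\<close>

text \<open>\<open>Ck_on\<close> gives continuity of the derivative one direction at a time. The
  operator norm is therefore dominated by the continuous sum \<open>g\<close> over basis vectors,
  which is bounded near \<open>a\<close>; the mean value inequality on a ball finishes.\<close>

lemma Ck_on_1_locally_lipschitz:
  fixes F :: "'a::euclidean_space \<Rightarrow> 'b::euclidean_space"
  assumes "Ck_on 1 F U" "open U" "a \<in> U"
  obtains e L where "e > 0" "ball a e \<subseteq> U"
    "\<And>x y. x \<in> ball a e \<Longrightarrow> y \<in> ball a e \<Longrightarrow> dist (F x) (F y) \<le> L * dist x y"
proof -
  define F' where "F' = (\<lambda>x. frechet_derivative F (at x))"
  define g where "g = (\<lambda>x. \<Sum>b\<in>Basis. norm (F' x b))"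
  have D: "(F has_derivative F' x) (at x)" if "x \<in> U" for x
    using assms(1) that by (auto simp: F'_def frechet_derivative_works)
  have "continuous_on U g"
    using assms(1) unfolding g_def F'_def by (intro continuous_intros) auto
  then have "isCont g a"
    using assms(2,3) continuous_on_eq_continuous_at by blast
  then have "\<forall>\<^sub>F x in at a. g x < g a + 1"
    unfolding isCont_def by (rule order_tendstoD) simp
  then obtain d where d: "d > 0" "\<And>x. dist x a < d \<Longrightarrow> g x \<le> g a + 1"
    unfolding eventually_at by (metis less_add_one less_imp_le UNIV_I)
  obtain d' where d': "d' > 0" "ball a d' \<subseteq> U"
    using assms(2,3) open_contains_ball by blast
  define e where "e = min d d'"
  have e: "e > 0" "ball a e \<subseteq> U" using d(1) d' by (auto simp: e_def)
  have on: "onorm (F' x) \<le> g a + 1" if x: "x \<in> ball a e" for x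
  proof (rule onorm_le)
    fix v
    have lin: "linear (F' x)" using D e(2) x by (blast intro: has_derivative_linear)
    have "F' x v = (\<Sum>b\<in>Basis. (v \<bullet> b) *\<^sub>R F' x b)"
      by (subst euclidean_representation[of v, symmetric])
         (simp add: linear_sum[OF lin] linear_cmul[OF lin] del: euclidean_representation)
    also have "norm \<dots> \<le> (\<Sum>b\<in>Basis. norm v * norm (F' x b))"
      by (rule order_trans[OF norm_sum]) (auto intro!: sum_mono mult_right_mono simp: Basis_le_norm)
    also have "\<dots> = g x * norm v" by (simp add: g_def sum_distrib_left sum_distrib_right mult.commute)
    also have "\<dots> \<le> (g a + 1) * norm v"
      using x d(2)[of x] by (intro mult_right_mono) (auto simp: e_def dist_commute)
    finally show "norm (F' x v) \<le> (g a + 1) * norm v" .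
  qed
  have "dist (F x) (F y) \<le> (g a + 1) * dist x y" if "x \<in> ball a e" "y \<in> ball a e" for x y
    unfolding dist_norm using that D e(2) on
    by (intro differentiable_bound[of "ball a e" F F']) (blast intro: has_derivative_at_withinI | simp)+
  with e show thesis by (rule that)
qed

lemma torus_C1_locally_lipschitz:
  assumes "torus_Ck 1 h"
  obtains e L where "e > 0"
    "\<And>x y. x \<in> ball a e \<Longrightarrow> y \<in> ball a e \<Longrightarrow> dist (h (to_torus x)) (h (to_torus y)) \<le> L * dist x y"
proof -
  obtain U F where U: "open U" "a \<in> U" "Ck_on 1 F U" "\<And>x. x \<in> U \<Longrightarrow> to_torus (F x) = h (to_torus x)"
    using assms unfolding torus_Ck_def by metis
  obtain e L where e: "e > 0" "ball a e \<subseteq> U"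
    "\<And>x y. x \<in> ball a e \<Longrightarrow> y \<in> ball a e \<Longrightarrow> dist (F x) (F y) \<le> L * dist x y"
    using Ck_on_1_locally_lipschitz[OF U(3,1,2)] by metis
  have "dist (h (to_torus x)) (h (to_torus y)) \<le> L * dist x y" if "x \<in> ball a e" "y \<in> ball a e" for x y
    using order_trans[OF dist_to_torus_le e(3)[OF that]] U(4) e(2) that by (metis subsetD)
  with e(1) show thesis by (rule that)
qed

text \<open>
  Under \<open>T\<^sub>1 = torus_prod f b\<close> the points \<open>(0, 0)\<close> and \<open>(x\<^sub>0, 0)\<close> approach each other faster than
  any two points can approach each other under \<open>T\<^sub>2\<close>. As a subsequence of the orbit of \<open>(0, 0)\<close>
  converges, Lipschitz continuity of the conjugacy near a single limit point is enough.
\<close>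
lemma contraction_rates_not_C1_conjugate:
  assumes f: "circle_lift f" "f 0 = 0"
    and contr: "\<And>n. \<bar>(f ^^ n) x\<^sub>0\<bar> \<le> c ^ n * \<bar>x\<^sub>0\<bar>" and x0: "x\<^sub>0 \<notin> \<int>"
    and expand: "\<And>p q. dist p q \<le> K * dist (T p) (T q)"
    and c: "c \<ge> 0" "c < 1" and K: "K \<ge> 0" "K * c < 1"
  shows "\<not> C1_conjugate (torus_prod f b) T"
proof
  assume "C1_conjugate (torus_prod f b) T"
  then obtain h where h: "torus_Ck 1 h" "bij h" "h \<circ> torus_prod f b = T \<circ> h"
    by (auto simp: C1_conjugate_def torus_Ck_diffeomorphism_def)
  \<comment> \<open>Reduction modulo 1 keeps the representatives in \<open>[0, 1]\<close>, where a
    convergent subsequence exists.\<close>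
  define y where "y n = frac (real n * b)" for n
  define u where "u n = (0 :: real, y n)" for n
  define v where "v n = ((f ^^ n) x\<^sub>0, y n)" for n
  define D where "D = dist (h (to_torus (0, 0))) (h (to_torus (x\<^sub>0, 0)))"
  have "to_torus (0, 0) \<noteq> to_torus (x\<^sub>0, 0)" using x0 by (simp add: to_torus_eq_iff)
  then have D: "D > 0" using h(2) by (simp add: D_def bij_def inj_eq)
  have hn: "h ((torus_prod f b ^^ n) p) = (T ^^ n) (h p)" for n p
    by (induction n) (use h(3) in \<open>auto simp: fun_eq_iff\<close>)
  have expand_n: "dist p q \<le> K ^ n * dist ((T ^^ n) p) ((T ^^ n) q)" for n p q
  proof (induction n)
    case (Suc n)
    have "K ^ n * dist ((T ^^ n) p) ((T ^^ n) q) \<le> K ^ n * (K * dist ((T ^^ Suc n) p) ((T ^^ Suc n) q))"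
      using expand K(1) by (intro mult_left_mono) auto
    with Suc show ?case by (simp add: algebra_simps)
  qed simp
  have f0: "(f ^^ n) 0 = 0" for n by (induction n) (use f(2) in auto)
  have frac: "y n - real n * b \<in> \<int>" for n by (simp add: y_def frac_def)
  have u: "(torus_prod f b ^^ n) (to_torus (0, 0)) = to_torus (u n)" for n
    using frac[of n] by (auto simp: torus_prod_funpow[OF f(1)] f0 u_def to_torus_eq_iff)
  have v: "(torus_prod f b ^^ n) (to_torus (x\<^sub>0, 0)) = to_torus (v n)" for n
    using frac[of n] by (auto simp: torus_prod_funpow[OF f(1)] v_def to_torus_eq_iff)
  have "\<forall>n. y n \<in> {0..1}" by (auto simp: y_def frac_lt_1 less_imp_le)
  then obtain z r where r: "strict_mono r" "(y \<circ> r) \<longlonglongrightarrow> z"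
    using compact_imp_seq_compact[OF compact_Icc] unfolding seq_compact_def by metis
  obtain e L where e: "e > 0" "\<And>x y. x \<in> ball (0, z) e \<Longrightarrow> y \<in> ball (0, z) e \<Longrightarrow>
      dist (h (to_torus x)) (h (to_torus y)) \<le> L * dist x y"
    using torus_C1_locally_lipschitz[OF h(1)] by metis
  have "(\<lambda>n. c ^ n * \<bar>x\<^sub>0\<bar>) \<longlonglongrightarrow> 0"
    using c by (intro tendsto_mult_left_zero LIMSEQ_realpow_zero)
  then have "(\<lambda>n. (f ^^ n) x\<^sub>0) \<longlonglongrightarrow> 0"
    by (rule Lim_null_comparison[rotated]) (use contr in auto)
  then have fr: "(\<lambda>n. (f ^^ r n) x\<^sub>0) \<longlonglongrightarrow> 0"
    using LIMSEQ_subseq_LIMSEQ[OF _ r(1)] by (force simp: o_def)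
  have "(\<lambda>n. u (r n)) \<longlonglongrightarrow> (0, z)" "(\<lambda>n. v (r n)) \<longlonglongrightarrow> (0, z)"
    unfolding u_def v_def using r(2) fr by (auto intro!: tendsto_Pair simp: o_def)
  then have "\<forall>\<^sub>F n in sequentially. u (r n) \<in> ball (0, z) e" "\<forall>\<^sub>F n in sequentially. v (r n) \<in> ball (0, z) e"
    using e(1) by (auto simp: tendsto_iff dist_commute)
  \<comment> \<open>At time \<open>r n\<close> the orbit points differ by at most
    \<open>c ^ r n * \<bar>x\<^sub>0\<bar>\<close>, \<open>h\<close> multiplies this by at most
    \<open>\<bar>L\<bar>\<close>, and going back \<open>r n\<close> steps of \<open>T\<close> costs
    \<open>K ^ r n\<close>. As \<open>K * c < 1\<close>, the fixed distance \<open>D\<close> cannot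
    be positive.\<close>
  then have ev: "\<forall>\<^sub>F n in sequentially. D \<le> \<bar>L\<bar> * \<bar>x\<^sub>0\<bar> * (K * c) ^ r n"
  proof eventually_elim
    case (elim n)
    have "D \<le> K ^ r n * dist (h (to_torus (u (r n)))) (h (to_torus (v (r n))))"
      unfolding D_def u[symmetric] v[symmetric] hn by (rule expand_n)
    also have "\<dots> \<le> K ^ r n * (L * dist (u (r n)) (v (r n)))"
      using e(2)[OF elim] K(1) by (intro mult_left_mono) auto
    also have "dist (u (r n)) (v (r n)) = \<bar>(f ^^ r n) x\<^sub>0\<bar>"
      by (simp add: u_def v_def dist_Pair_Pair)
    also have "K ^ r n * (L * \<bar>(f ^^ r n) x\<^sub>0\<bar>) \<le> K ^ r n * (\<bar>L\<bar> * (c ^ r n * \<bar>x\<^sub>0\<bar>))"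
      using contr K(1) by (intro mult_left_mono mult_mono) auto
    finally show ?case by (simp add: power_mult_distrib mult_ac)
  qed
  have "(\<lambda>n. (K * c) ^ r n) \<longlonglongrightarrow> 0"
    using LIMSEQ_subseq_LIMSEQ[OF LIMSEQ_realpow_zero[of "K * c"] r(1)] c(1) K by (simp add: o_def)
  then have "(\<lambda>n. \<bar>L\<bar> * \<bar>x\<^sub>0\<bar> * (K * c) ^ r n) \<longlonglongrightarrow> 0"
    by (rule tendsto_mult_right_zero)
  then have "D \<le> 0"
    by (rule tendsto_lowerbound[OF _ ev]) simp
  with D show False by simp
qed

lemma proj_map_not_C1_conjugate:
  "\<not> C1_conjugate (torus_prod (proj_map (1 / 4)) b) (torus_prod (proj_map (1 / 2)) b)"
proof -
  let ?f = "proj_map (1 / 4)" and ?T = "torus_prod (proj_map (1 / 2)) b"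
  \<comment> \<open>\<open>3 / 10\<close> exceeds the multiplier \<open>1 / 4\<close> at 0 but stays
    below \<open>1 / 2\<close>, so that \<open>2 * (3 / 10) < 1\<close>.\<close>
  obtain e where e: "e > 0" "\<And>x. \<bar>x\<bar> < e \<Longrightarrow> \<bar>?f x\<bar> \<le> 3 / 10 * \<bar>x\<bar>"
    using proj_map_contraction[of "1 / 4" "3 / 10"] by auto
  \<comment> \<open>Inside the contracted neighbourhood, and strictly between 0 and 1, so distinct
    from 0 on the circle.\<close>
  define x\<^sub>0 where "x\<^sub>0 = min (e / 2) (1 / 2)"
  have x0: "0 < x\<^sub>0" "x\<^sub>0 < e" "x\<^sub>0 < 1" using e(1) by (auto simp: x\<^sub>0_def)
  have contr: "\<bar>(?f ^^ n) x\<^sub>0\<bar> \<le> (3 / 10) ^ n * \<bar>x\<^sub>0\<bar>" for n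
  proof (induction n)
    case (Suc n)
    have "(3 / 10) ^ n * \<bar>x\<^sub>0\<bar> \<le> 1 * \<bar>x\<^sub>0\<bar>" by (intro mult_right_mono power_le_one) auto
    then have "\<bar>(?f ^^ n) x\<^sub>0\<bar> < e" using Suc x0 by linarith
    from e(2)[OF this] Suc show ?case by simp
  qed simp
  have "x\<^sub>0 \<notin> \<int>" using x0 by (auto elim!: Ints_cases)
  \<comment> \<open>The inverse of \<open>?T\<close> is
    \<open>torus_prod (proj_map 2) (- b)\<close>, which is 2-Lipschitz.\<close>
  have "dist p q \<le> 2 * dist (?T p) (?T q)" for p q
  proof -
    have inv: "torus_prod (proj_map 2) (- b) (?T p) = p" for p
      using torus_prod_proj_map_inverse'[of "1 / 2" b] by (simp add: fun_eq_iff)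
    show ?thesis
      using torus_prod_lipschitz[OF circle_lift_proj_map[of 2] proj_map_lipschitz[of 2], of "- b" "?T p" "?T q"]
      by (simp add: inv)
  qed
  then show ?thesis
    using contr \<open>x\<^sub>0 \<notin> \<int>\<close>
    by (intro contraction_rates_not_C1_conjugate[where c = "3 / 10" and K = 2 and x\<^sub>0 = x\<^sub>0]
        circle_lift_proj_map proj_map_0) auto
qed

theorem theorem1p3:
  shows "\<exists>T\<^sub>1 T\<^sub>2 :: torus \<Rightarrow> torus.
    torus_smooth_diffeomorphism T\<^sub>1 \<and> torus_smooth_diffeomorphism T\<^sub>2 \<and>
    (\<exists>\<tau>>0. \<exists>C>0. \<forall>x. \<forall>n\<ge>1.
       dist ((T\<^sub>1 ^^ n) x) x \<ge> C * real n powr (- \<tau>) \<and>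
       dist ((T\<^sub>2 ^^ n) x) x \<ge> C * real n powr (- \<tau>)) \<and>
    C0_conjugate T\<^sub>1 T\<^sub>2 \<and> \<not> C1_conjugate T\<^sub>1 T\<^sub>2"
proof -
  let ?T\<^sub>1 = "torus_prod (proj_map (1 / 4)) (sqrt 2)" and ?T\<^sub>2 = "torus_prod (proj_map (1 / 2)) (sqrt 2)"
  \<comment> \<open>The multipliers are \<open>l^2\<close> and \<open>l\<close> for
    \<open>l = 1 / 2\<close>.\<close>
  have "C0_conjugate ?T\<^sub>1 ?T\<^sub>2"
    using proj_map_C0_conjugate[of "1 / 2" "sqrt 2"] by (simp add: power2_eq_square)
  moreover have "\<exists>\<tau>>0. \<exists>C>0. \<forall>x. \<forall>n\<ge>1.
       dist ((?T\<^sub>1 ^^ n) x) x \<ge> C * real n powr (- \<tau>) \<and>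
       dist ((?T\<^sub>2 ^^ n) x) x \<ge> C * real n powr (- \<tau>)"
    \<comment> \<open>Exponent 1 and constant \<open>1 / 4\<close> come from the bound
      \<open>1 / (4 n)\<close> for sqrt 2, which concerns the second coordinate only.\<close>
    by (intro exI[of _ "1 :: real"] exI[of _ "1 / 4 :: real"] conjI allI impI
        torus_prod_slow_recurrence circle_lift_proj_map) auto
  moreover have "torus_smooth_diffeomorphism ?T\<^sub>1" "torus_smooth_diffeomorphism ?T\<^sub>2"
    by (simp_all add: torus_smooth_diffeomorphism_torus_prod)
  ultimately show ?thesis using proj_map_not_C1_conjugate by blast
qed

end
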